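(* Let $\phi$ be a self-map of $\mathbb{H}$ of parabolic zero-step type, and let $h$ be the Baker–Pommerenke semiconjugation of $\phi$ based at some point $z_0\in\mathbb{H}$. Given $(\sigma,\tau)\in\mathcal{P}(\phi)$, there is an entire function $F$ such that $$\sigma=F\circ h\qquad\text{and}\qquad F(z+1)=\tau\circ F(z)\quad(z\in\mathbb{C}).$$ Moreover, $\sigma$ is canonical (with respect to $\phi$ and $\tau$) if and only if $F$ is canonical (with respect to $z\mapsto z+1$ on $\mathbb{C}$ and $\tau$).
   Context: $\mathbb{H}=\{z\in\mathbb{C}:\operatorname{Im}z>0\}$, $\rho_{\mathbb{H}}$ is the hyperbolic distance, $\phi_n$ is the $n$-th iterate of $\phi$, and $\operatorname{Aut}(\mathbb{C})=\{z\mapsto az+b: a\neq0\}$. n.t.-lim as $z\to\infty$ means the limit as $z\to\infty$ inside each sector $\{|\operatorname{Arg}z-\pi/2|<\theta\}$, $0<\theta<\pi/2$. A self-map of $\mathbb{H}$ of parabolic zero-step type is an analytic map $\phi:\mathbb{H}\to\mathbb{H}$, not an automorphism, of the form $\phi(z)=z+p(z)$ with $\operatorname{Im}p>0$ on $\mathbb{H}$ and n.t.-$\lim_{z\to\infty}p(z)/z=0$, such that $\rho_{\mathbb{H}}(\phi_n(z),\phi_{n+1}(z))\to0$ for one (equivalently, every) $z\in\mathbb{H}$. Baker–Pommerenke semiconjugation based at $z_0$: let $z_n=\phi_n(z_0)$ and $\mu_n(z)=\frac{z-z_n}{z_{n+1}-z_n}$. By a theorem of Baker and Pommerenke, $h=\lim_{n}\mu_n\circ\phi_n$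 exists locally uniformly in $\mathbb{H}$, $h(z_0)=0$, and $h\circ\phi=h+1$. $\mathcal{P}(\phi)$ is the set of pairs $(\sigma,\tau)$ with $\sigma:\mathbb{H}\to\mathbb{C}$ analytic and non-constant, $\tau\in\operatorname{Aut}(\mathbb{C})$, and $\sigma\circ\phi=\tau\circ\sigma$. Two points $z,w$ are in the same grand orbit of a map $\psi$ if $\psi_n(z)=\psi_k(w)$ for some integers $n,k\ge0$; $\mathcal{G}(\psi)$ is the set of grand orbits ($\phi$ acts on $\mathbb{H}$; $\tau$ and $z\mapsto z+1$ act on $\mathbb{C}$). If $f\circ\psi=\tau\circ f$, then $f$ induces a map $\mathcal{G}(\psi)\to\mathcal{G}(\tau)$; $f$ is canonical (with respect to $\psi$ and $\tau$) if this map is a bijection. *)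

theory Defs
  imports "HOL-Complex_Analysis.Complex_Analysis"
begin

definition upper_half_plane :: "complex set"
  where "upper_half_plane = {z. Im z > 0}"

text \<open>Hyperbolic distance of the half-plane, normalised to curvature \<open>-1\<close>.\<close>

definition hyp_dist :: "complex \<Rightarrow> complex \<Rightarrow> real"
  where "hyp_dist z w = arcosh (1 + (cmod (z - w))\<^sup>2 / (2 * Im z * Im w))"

definition nt_sector :: "real \<Rightarrow> complex set"
  where "nt_sector \<theta> = {z. \<bar>Arg z - pi / 2\<bar> < \<theta>}"

definition nt_tendsto :: "(complex \<Rightarrow> complex) \<Rightarrow> complex \<Rightarrow> bool"
  where "nt_tendsto f l \<longleftrightarrow>
    (\<forall>\<theta>. 0 < \<theta> \<and> \<theta> < pi / 2 \<longrightarrow> (f \<longlongrightarrow> l) (inf at_infinity (principal (nt_sector \<theta>))))"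

definition automorphism_on :: "complex set \<Rightarrow> (complex \<Rightarrow> complex) \<Rightarrow> bool"
  where "automorphism_on S f \<longleftrightarrow>
    f holomorphic_on S \<and> bij_betw f S S \<and> inv_into S f holomorphic_on S"

text \<open>The zero-step condition is required at one point only; the Schwarz-Pick lemma then
  gives it at every point.\<close>

definition parabolic_zero_step :: "(complex \<Rightarrow> complex) \<Rightarrow> bool"
  where "parabolic_zero_step \<phi> \<longleftrightarrow>
    \<phi> holomorphic_on upper_half_plane \<and>
    \<phi> ` upper_half_plane \<subseteq> upper_half_plane \<and>
    \<not> automorphism_on upper_half_plane \<phi> \<and>
    (\<exists>p. (\<forall>z\<in>upper_half_plane. \<phi> z = z + p z \<and> Im (p z) > 0) \<and> nt_tendsto (\<lambda>z. p z / z) 0) \<and>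
    (\<exists>z\<in>upper_half_plane. (\<lambda>n. hyp_dist ((\<phi> ^^ n) z) ((\<phi> ^^ Suc n) z)) \<longlonglongrightarrow> 0)"

definition bp_mu :: "(complex \<Rightarrow> complex) \<Rightarrow> complex \<Rightarrow> nat \<Rightarrow> complex \<Rightarrow> complex"
  where "bp_mu \<phi> z\<^sub>0 n z = (z - (\<phi> ^^ n) z\<^sub>0) / ((\<phi> ^^ Suc n) z\<^sub>0 - (\<phi> ^^ n) z\<^sub>0)"

text \<open>The limit determines \<open>h\<close> on the half-plane only; its values elsewhere are arbitrary.
  The functional equation \<open>h \<circ> \<phi> = h + 1\<close> is a consequence and not part of the definition.\<close>

definition baker_pommerenke ::
  "(complex \<Rightarrow> complex) \<Rightarrow> complex \<Rightarrow> (complex \<Rightarrow> complex) \<Rightarrow> bool"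
  where "baker_pommerenke \<phi> z\<^sub>0 h \<longleftrightarrow>
    (\<forall>K. compact K \<and> K \<subseteq> upper_half_plane \<longrightarrow>
      uniform_limit K (\<lambda>n z. bp_mu \<phi> z\<^sub>0 n ((\<phi> ^^ n) z)) h sequentially)"

definition Aut_C :: "(complex \<Rightarrow> complex) set"
  where "Aut_C = {\<tau>. \<exists>a b. a \<noteq> 0 \<and> \<tau> = (\<lambda>z. a * z + b)}"

definition semiconjugations ::
  "(complex \<Rightarrow> complex) \<Rightarrow> ((complex \<Rightarrow> complex) \<times> (complex \<Rightarrow> complex)) set"
  where "semiconjugations \<phi> = {(\<sigma>, \<tau>).
    \<sigma> holomorphic_on upper_half_plane \<and> \<not> \<sigma> constant_on upper_half_plane \<and>
    \<tau> \<in> Aut_C \<and> (\<forall>z\<in>upper_half_plane. \<sigma> (\<phi> z) = \<tau> (\<sigma> z))}"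

definition grand_orbit_rel :: "'a set \<Rightarrow> ('a \<Rightarrow> 'a) \<Rightarrow> ('a \<times> 'a) set"
  where "grand_orbit_rel X \<psi> = {(z, w). z \<in> X \<and> w \<in> X \<and> (\<exists>n k. (\<psi> ^^ n) z = (\<psi> ^^ k) w)}"

definition grand_orbits :: "'a set \<Rightarrow> ('a \<Rightarrow> 'a) \<Rightarrow> 'a set set"
  where "grand_orbits X \<psi> = X // grand_orbit_rel X \<psi>"

text \<open>If \<open>f\<close> semiconjugates \<open>\<psi>\<close> to \<open>\<tau>\<close>, it maps each grand orbit of \<open>\<psi>\<close> into a single grand
  orbit of \<open>\<tau>\<close>, and the saturation below is that grand orbit.\<close>

definition induced_orbit_map :: "('b \<Rightarrow> 'b) \<Rightarrow> ('a \<Rightarrow> 'b) \<Rightarrow> 'a set \<Rightarrow> 'b set"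
  where "induced_orbit_map \<tau> f A = grand_orbit_rel UNIV \<tau> `` (f ` A)"

definition canonical :: "'a set \<Rightarrow> ('a \<Rightarrow> 'a) \<Rightarrow> ('b \<Rightarrow> 'b) \<Rightarrow> ('a \<Rightarrow> 'b) \<Rightarrow> bool"
  where "canonical X \<psi> \<tau> f \<longleftrightarrow>
    bij_betw (induced_orbit_map \<tau> f) (grand_orbits X \<psi>) (grand_orbits UNIV \<tau>)"

end

theory Submission
  imports Defs
begin

text \<open>Write \<open>p z = \<phi> z - z\<close>, a holomorphic self-map of the half-plane. Schwarz-Pick for the iterates
  of \<open>\<phi>\<close> and for \<open>p\<close> carries the zero-step condition to the orbit \<open>z\<^sub>n\<close> of \<open>z\<^sub>0\<close> in the form
  \<open>|p z\<^sub>n| / Im z\<^sub>n \<rightarrow> 0\<close>, and gives \<open>p z\<^sub>n\<^sub>+\<^sub>1 / p z\<^sub>n \<rightarrow> 1\<close>, whence \<open>h \<circ> \<phi> = h + 1\<close>. On every hyperbolic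
  disc of fixed radius about \<open>z\<^sub>n\<close>, \<open>n\<close> large, all iterates of \<open>\<phi>\<close> are injective, hence so is \<open>h\<close> by
  Hurwitz; therefore \<open>h z = h w\<close> forces the orbits of \<open>z\<close> and \<open>w\<close> to meet. Schottky's theorem shows
  that the integer translates of the image of \<open>h\<close> cover the plane. Consequently \<open>h\<close> is canonical, \<open>\<sigma>\<close> is
  constant on the fibres of \<open>h\<close>, and the induced function on the image of \<open>h\<close> extends to an
  entire function through \<open>F (\<zeta> + 1) = \<tau> (F \<zeta>)\<close>.\<close>

section \<open>Schwarz-Pick and Harnack estimates in the half-plane\<close>

lemma open_upper_half_plane: "open upper_half_plane"
  using open_halfspace_Im_gt[of 0] by (simp add: upper_half_plane_def)

lemma connected_upper_half_plane: "connected upper_half_plane"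
  using convex_halfspace_Im_gt[of 0] by (simp add: upper_half_plane_def convex_connected)

text \<open>Links the pseudohyperbolic quotient \<open>cmod (z - w) / cmod (z - cnj w)\<close> with
  \<open>(cmod (z - w))\<^sup>2 / (Im z * Im w)\<close>.\<close>

lemma cmod_diff_cnj_sq:
  "(cmod (z - cnj w))\<^sup>2 = (cmod (z - w))\<^sup>2 + 4 * (Im z * Im w)"
  by (simp only: cmod_power2) (simp add: algebra_simps power2_eq_square)

lemma cmod_diff_less_cmod_diff_cnj:
  assumes "Im z > 0" "Im w > 0"
  shows "cmod (z - w) < cmod (z - cnj w)"
proof -
  have "Im z * Im w > 0" using assms by simp
  then have "(cmod (z - w))\<^sup>2 < (cmod (z - cnj w))\<^sup>2"
    by (simp add: cmod_diff_cnj_sq)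
  then show ?thesis by (rule power_less_imp_less_base) simp
qed

text \<open>Cayley transforms centred at \<open>w\<close> and \<open>f w\<close> turn
  \<open>f\<close> into a self-map of the unit disc fixing 0, to which the Schwarz lemma
  applies.\<close>

lemma Schwarz_Pick_half_plane:
  assumes holf: "f holomorphic_on upper_half_plane"
    and maps: "\<And>z. Im z > 0 \<Longrightarrow> Im (f z) > 0"
    and z: "Im z > 0" and w: "Im w > 0"
  shows "(cmod (f z - f w))\<^sup>2 * (Im z * Im w) \<le> (cmod (z - w))\<^sup>2 * (Im (f z) * Im (f w))"
proof -
  \<comment> \<open>\<open>k\<close> inverts the Cayley transform
    \<open>z \<mapsto> (z - w) / (z - cnj w)\<close>, and \<open>g\<close> is \<open>f\<close>
    followed by the Cayley transform at \<open>f w\<close>, read in the disc.\<close>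
  define k where "k \<zeta> = (w - cnj w * \<zeta>) / (1 - \<zeta>)" for \<zeta>
  define g where "g \<zeta> = (f (k \<zeta>) - f w) / (f (k \<zeta>) - cnj (f w))" for \<zeta>
  have ne1: "1 - \<zeta> \<noteq> 0" if "cmod \<zeta> < 1" for \<zeta> using that by auto
  have nec: "x - cnj y \<noteq> 0" if "Im x > 0" "Im y > 0" for x y
    using that by (auto simp: complex_eq_iff)
  have Imk: "Im (k \<zeta>) > 0" if "cmod \<zeta> < 1" for \<zeta>
  proof -
    have "Im (k \<zeta>) * (cmod (1 - \<zeta>))\<^sup>2 = Im w * (1 - (cmod \<zeta>)\<^sup>2)"
      using ne1[OF that] unfolding k_def
      by (simp add: Im_divide cmod_power2 complex_eq_iff add_nonneg_eq_0_iff)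
         (simp add: algebra_simps power2_eq_square)
    moreover have "Im w * (1 - (cmod \<zeta>)\<^sup>2) > 0"
      using w that by (simp add: power_less_one_iff)
    ultimately show ?thesis
      by (metis zero_less_mult_pos2 ne1[OF that] zero_less_norm_iff zero_less_power)
  qed
  have "k holomorphic_on ball 0 1"
    unfolding k_def by (intro holomorphic_intros) (use ne1 in auto)
  then have "(f \<circ> k) holomorphic_on ball 0 1"
    by (rule holomorphic_on_compose_gen[OF _ holf]) (auto simp: upper_half_plane_def Imk)
  then have holfk: "(\<lambda>\<zeta>. f (k \<zeta>)) holomorphic_on ball 0 1" by (simp add: o_def)
  have "g holomorphic_on ball 0 1"
    unfolding g_def by (intro holomorphic_intros holfk) (use nec Imk maps w in auto)
  moreover have "g 0 = 0" by (simp add: g_def k_def)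
  moreover have "cmod (g \<zeta>) < 1" if "cmod \<zeta> < 1" for \<zeta>
    using cmod_diff_less_cmod_diff_cnj[OF maps[OF Imk[OF that]] maps[OF w]]
      nec[OF maps[OF Imk[OF that]] maps[OF w]]
    by (simp add: g_def norm_divide divide_less_eq)
  moreover define \<zeta> where "\<zeta> = (z - w) / (z - cnj w)"
  have \<zeta>1: "cmod \<zeta> < 1"
    using cmod_diff_less_cmod_diff_cnj[OF z w] nec[OF z w]
    by (simp add: \<zeta>_def norm_divide divide_less_eq)
  ultimately have "cmod (g \<zeta>) \<le> cmod \<zeta>"
    using Schwarz_Lemma(1)[of g \<zeta>] by auto
  moreover have "k \<zeta> = z"
  proof -
    have "1 - \<zeta> = (w - cnj w) / (z - cnj w)" "w - cnj w * \<zeta> = z * (w - cnj w) / (z - cnj w)"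
      using nec[OF z w] by (simp_all add: \<zeta>_def field_simps)
    then show ?thesis using nec[OF z w] nec[OF w w] by (simp add: k_def)
  qed
  ultimately have "cmod (f z - f w) / cmod (f z - cnj (f w)) \<le> cmod (z - w) / cmod (z - cnj w)"
    by (simp add: g_def \<zeta>_def norm_divide)
  then have "cmod (f z - f w) * cmod (z - cnj w) \<le> cmod (z - w) * cmod (f z - cnj (f w))"
    using nec[OF z w] nec[OF maps[OF z] maps[OF w]] by (simp add: divide_simps mult.commute)
  then have "(cmod (f z - f w) * cmod (z - cnj w))\<^sup>2 \<le> (cmod (z - w) * cmod (f z - cnj (f w)))\<^sup>2"
    by (rule power_mono) simp
  \<comment> \<open>After expanding both conjugate factors, the product of the squares of
    \<open>cmod (f z - f w)\<close> and \<open>cmod (z - w)\<close> occurs on both sides and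
    cancels.\<close>
  then show ?thesis
    by (simp add: power_mult_distrib cmod_diff_cnj_sq algebra_simps)
qed

text \<open>With \<open>hyp_ratio z w = 2 (cosh (\<rho>(z, w)) - 1)\<close>, all hyperbolic estimates below become
  rational.\<close>

definition hyp_ratio :: "complex \<Rightarrow> complex \<Rightarrow> real"
  where "hyp_ratio z w = (cmod (z - w))\<^sup>2 / (Im z * Im w)"

lemma hyp_ratio_commute: "hyp_ratio z w = hyp_ratio w z"
  by (simp add: hyp_ratio_def norm_minus_commute mult.commute)

lemma hyp_dist_commute: "hyp_dist z w = hyp_dist w z"
  by (simp add: hyp_dist_def norm_minus_commute mult_ac)

lemma hyp_ratio_nonneg: "Im z > 0 \<Longrightarrow> Im w > 0 \<Longrightarrow> hyp_ratio z w \<ge> 0"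
  by (simp add: hyp_ratio_def)

lemma hyp_ratio_eq_hyp_dist:
  assumes "Im z > 0" "Im w > 0"
  shows "hyp_ratio z w = 2 * (cosh (hyp_dist z w) - 1)"
proof -
  have "cosh (hyp_dist z w) = 1 + (cmod (z - w))\<^sup>2 / (2 * Im z * Im w)"
    unfolding hyp_dist_def by (rule cosh_arcosh_real) (use assms in simp)
  then show ?thesis by (simp add: hyp_ratio_def)
qed

lemma hyp_ratio_contract:
  assumes "f holomorphic_on upper_half_plane" "\<And>z. Im z > 0 \<Longrightarrow> Im (f z) > 0"
    and "Im z > 0" "Im w > 0"
  shows "hyp_ratio (f z) (f w) \<le> hyp_ratio z w"
  using Schwarz_Pick_half_plane[OF assms] assms(2)[OF assms(3)] assms(2)[OF assms(4)] assms(3,4)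
  unfolding hyp_ratio_def by (subst frac_le_eq) (auto intro!: divide_nonpos_pos)

text \<open>Common core of the two Harnack estimates: expand the square, drop \<open>t * t\<close>,
  divide by \<open>s\<close>.\<close>

lemma le_of_diff_sq_le:
  fixes s t K :: real
  assumes "s > 0" "t > 0" "(s - t)\<^sup>2 \<le> K * (s * t)"
  shows "s \<le> (K + 2) * t"
proof -
  have "s * s \<le> s * ((K + 2) * t) - t * t" using assms(3) by (simp add: power2_eq_square algebra_simps)
  also have "\<dots> \<le> s * ((K + 2) * t)" using assms by simp
  finally show ?thesis using assms(1) by simp
qed

lemma Harnack_Im:
  assumes "Im z > 0" "Im w > 0" "hyp_ratio z w \<le> K"
  shows "Im z \<le> (K + 2) * Im w"
proof (rule le_of_diff_sq_le)
  have "\<bar>Im (z - w)\<bar> ^ 2 \<le> (cmod (z - w))\<^sup>2" by (intro power_mono abs_Im_le_cmod) simp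
  also have "\<dots> \<le> K * (Im z * Im w)"
    using assms by (simp add: hyp_ratio_def pos_divide_le_eq)
  finally show "(Im z - Im w)\<^sup>2 \<le> K * (Im z * Im w)" by simp
qed (use assms in auto)

text \<open>Since \<open>Im z * Im w \<le> cmod z * cmod w\<close>, moduli obey the same inequality
  as imaginary parts. It serves to compare the moduli of values of \<open>p\<close>.\<close>

lemma Harnack_cmod:
  assumes "Im z > 0" "Im w > 0" "hyp_ratio z w \<le> K"
  shows "cmod z \<le> (K + 2) * cmod w"
proof (rule le_of_diff_sq_le)
  have K: "K \<ge> 0" using hyp_ratio_nonneg[OF assms(1,2)] assms(3) by linarith
  have "\<bar>cmod z - cmod w\<bar> ^ 2 \<le> (cmod (z - w))\<^sup>2" by (intro power_mono norm_triangle_ineq3) simp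
  also have "\<dots> \<le> K * (Im z * Im w)"
    using assms by (simp add: hyp_ratio_def pos_divide_le_eq)
  also have "\<dots> \<le> K * (cmod z * cmod w)"
    using K assms by (intro mult_left_mono mult_mono) (auto intro: order_trans[OF _ abs_Im_le_cmod])
  finally show "(cmod z - cmod w)\<^sup>2 \<le> K * (cmod z * cmod w)" by simp
qed (use assms in auto)

text \<open>Completing the square shows that hyperbolic discs are Euclidean discs, which makes them
  open and connected, as Hurwitz's theorem requires.\<close>

lemma hyp_ball_eq_ball:
  assumes "Im a > 0" "K > 0"
  shows "\<exists>c r. {z. Im z > 0 \<and> hyp_ratio z a < K} = ball c r"
proof -
  \<comment> \<open>The centre lies vertically above \<open>a\<close>, at the height that absorbs
    the term \<open>K * (Im z * Im a)\<close>, linear in \<open>Im z\<close>.\<close>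
  define c where "c = Complex (Re a) (Im a * (1 + K / 2))"
  define r where "r = sqrt ((Im a * (1 + K / 2))\<^sup>2 - (Im a)\<^sup>2)"
  have "(Im a)\<^sup>2 \<le> (Im a * (1 + K / 2))\<^sup>2" using assms by (intro power_mono) auto
  then have r: "r \<ge> 0" "r\<^sup>2 = (Im a * (1 + K / 2))\<^sup>2 - (Im a)\<^sup>2" by (auto simp: r_def)
  have eq: "(cmod (z - a))\<^sup>2 - K * (Im z * Im a) = (cmod (c - z))\<^sup>2 - r\<^sup>2" for z
    unfolding cmod_power2 r(2) c_def by (simp add: algebra_simps power2_eq_square)
  have "(Im z > 0 \<and> hyp_ratio z a < K) \<longleftrightarrow> z \<in> ball c r" for z
  proof -
    have "z \<in> ball c r \<longleftrightarrow> (cmod (c - z))\<^sup>2 < r\<^sup>2"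
      using r(1) by (auto simp: dist_norm intro: power_strict_mono power_less_imp_less_base)
    also have "\<dots> \<longleftrightarrow> (cmod (z - a))\<^sup>2 < K * (Im z * Im a)"
      using eq[of z] by linarith
    also have "\<dots> \<longleftrightarrow> Im z > 0 \<and> hyp_ratio z a < K"
    proof (intro iffI conjI)
      assume *: "(cmod (z - a))\<^sup>2 < K * (Im z * Im a)"
      \<comment> \<open>A point of the Euclidean disc lies in the half-plane because the strict
        inequality makes its right-hand side positive.\<close>
      then have "0 < K * (Im z * Im a)" by (rule le_less_trans[rotated]) simp
      then show "Im z > 0" using assms by (simp add: zero_less_mult_iff)
      then show "hyp_ratio z a < K" using * assms by (simp add: hyp_ratio_def pos_divide_less_eq)
    qed (use assms in \<open>auto simp: hyp_ratio_def pos_divide_less_eq\<close>)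
    finally show ?thesis by simp
  qed
  then show ?thesis by blast
qed

section \<open>Descent along a holomorphic map and extension by translation\<close>

text \<open>\<open>F\<close> takes the value of \<open>s\<close> at any preimage and is continuous
  by the open mapping theorem. A local inverse of \<open>h\<close> at a noncritical point makes
  \<open>F\<close> holomorphic at its image; isolatedness of the critical points leaves only
  removable singularities.\<close>

lemma holomorphic_factor_through:
  assumes S: "open S" "connected S"
    and holh: "h holomorphic_on S" and nc: "\<not> h constant_on S"
    and hols: "s holomorphic_on S"
    and fib: "\<And>z w. z \<in> S \<Longrightarrow> w \<in> S \<Longrightarrow> h z = h w \<Longrightarrow> s z = s w"
  shows "\<exists>F. F holomorphic_on h ` S \<and> (\<forall>z\<in>S. F (h z) = s z)"
proof -
  define F where "F \<zeta> = s (SOME z. z \<in> S \<and> h z = \<zeta>)" for \<zeta>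
  have Fh: "F (h z) = s z" if "z \<in> S" for z
  proof -
    have "(SOME y. y \<in> S \<and> h y = h z) \<in> S \<and> h (SOME y. y \<in> S \<and> h y = h z) = h z"
      by (rule someI[of _ z]) (use that in auto)
    then show ?thesis unfolding F_def by (intro fib) (use that in auto)
  qed
  have opn: "open (h ` U)" if "open U" "U \<subseteq> S" for U
    using open_mapping_thm[OF holh S that nc] .
  have cont: "continuous_on (h ` S) F"
    unfolding continuous_on_open_invariant
  proof (intro allI impI)
    fix B :: "complex set" assume B: "open B"
    show "\<exists>A. open A \<and> A \<inter> h ` S = F -` B \<inter> h ` S"
    proof (intro exI conjI)
      show "open (h ` (s -` B \<inter> S))"
        using B continuous_open_preimage[OF holomorphic_on_imp_continuous_on[OF hols] S(1), of B]
        by (intro opn) (auto simp: Int_commute)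
      show "h ` (s -` B \<inter> S) \<inter> h ` S = F -` B \<inter> h ` S"
        using Fh by auto
    qed
  qed
  have regular: "F field_differentiable at (h z)" if z: "z \<in> S" and d: "deriv h z \<noteq> 0" for z
  proof -
    obtain r where r: "r > 0" "ball z r \<subseteq> S" "inj_on h (ball z r)"
      using has_complex_derivative_locally_injective[OF holh z S(1) d] .
    obtain g where g: "g holomorphic_on h ` ball z r" "\<And>y. y \<in> ball z r \<Longrightarrow> g (h y) = y"
      using holomorphic_has_inverse[of h "ball z r"] r holh
      by (metis holomorphic_on_subset open_ball)
    have "(s \<circ> g) holomorphic_on h ` ball z r"
      by (rule holomorphic_on_compose_gen[OF g(1) hols]) (use g(2) r(2) in force)
    then have "F holomorphic_on h ` ball z r"
      by (rule holomorphic_transform) (use g(2) Fh r(2) in force)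
    then show ?thesis
      using r opn[OF open_ball r(2)] by (intro holomorphic_on_imp_differentiable_at) auto
  qed
  have "F field_differentiable at (h z)" if z: "z \<in> S" for z
  proof -
    \<comment> \<open>Either \<open>z\<close> is critical, and then an isolated zero of
      \<open>deriv h\<close>, which does not vanish identically, or \<open>deriv h\<close> is
      nonzero near \<open>z\<close> by continuity.\<close>
    have "\<exists>r>0. ball z r \<subseteq> S \<and> (\<forall>y\<in>ball z r - {z}. deriv h y \<noteq> 0)"
    proof (cases "deriv h z = 0")
      case True
      have "\<exists>b\<in>S. deriv h b \<noteq> 0"
      proof (rule ccontr)
        assume "\<not> ?thesis"
        then have "\<And>y. y \<in> S \<Longrightarrow> (h has_field_derivative 0) (at y)"
          by (metis holomorphic_derivI[OF holh S(1)])
        then have "h constant_on S"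
          using has_field_derivative_0_imp_constant_on[of S h] S by blast
        then show False using nc by simp
      qed
      then obtain b where b: "b \<in> S" "deriv h b \<noteq> 0" by blast
      show ?thesis
        using isolated_zeros[OF holomorphic_deriv[OF holh S(1)] S z True b] by metis
    next
      case False
      have "continuous_on S (deriv h)"
        by (intro holomorphic_on_imp_continuous_on holomorphic_deriv holh S)
      then have "open (S \<inter> deriv h -` (- {0}))"
        by (rule continuous_open_preimage) (use S in auto)
      moreover have "z \<in> S \<inter> deriv h -` (- {0})" using z False by auto
      ultimately obtain r where "r > 0" "ball z r \<subseteq> S \<inter> deriv h -` (- {0})"
        using open_contains_ball_eq by blast
      then show ?thesis by fastforce
    qed
    then obtain r where r: "r > 0" "ball z r \<subseteq> S" "\<And>y. y \<in> ball z r - {z} \<Longrightarrow> deriv h y \<noteq> 0"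
      by blast
    have "F holomorphic_on h ` ball z r"
    \<comment> \<open>Every other point of the image of the disc has a noncritical preimage in it,
      so only \<open>h z\<close> could be singular, and continuity of \<open>F\<close> removes
      it.\<close>
    proof (rule no_isolated_singularity[where K = "{h z}"])
      show "continuous_on (h ` ball z r) F"
        using cont by (rule continuous_on_subset) (use r in auto)
      show "open (h ` ball z r)" using opn r by auto
      show "F holomorphic_on h ` ball z r - {h z}"
        unfolding holomorphic_on_def
      proof
        fix x assume "x \<in> h ` ball z r - {h z}"
        then obtain y where y: "y \<in> ball z r - {z}" "x = h y" by (metis Diff_iff image_iff singletonI singletonD)
        then show "F field_differentiable at x within h ` ball z r - {h z}"
          using regular[of y] r by (blast intro: field_differentiable_at_within)
      qed
    qed auto
    then show ?thesis
      using r opn[OF open_ball r(2)] by (intro holomorphic_on_imp_differentiable_at) auto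
  qed
  then have "F holomorphic_on h ` S"
    by (auto simp: holomorphic_on_def intro: field_differentiable_at_within)
  then show ?thesis using Fh by blast
qed

text \<open>The functional equation forces the value at \<zeta>: shift by some \<open>m\<close> into
  \<Omega>, apply \<open>f\<close>, and undo the shift by \<open>m\<close> applications of the
  inverse \<tau>'.\<close>

lemma entire_extension_by_translation:
  assumes \<Omega>: "open \<Omega>" and step: "\<And>\<zeta>. \<zeta> \<in> \<Omega> \<Longrightarrow> \<zeta> + 1 \<in> \<Omega>"
    and cover: "\<And>\<zeta>. \<exists>m::nat. \<zeta> + of_nat m \<in> \<Omega>"
    and hol: "f holomorphic_on \<Omega>"
    and inv: "\<And>w. \<tau>' (\<tau> w) = w" "\<And>w. \<tau> (\<tau>' w) = w" and hol': "\<tau>' holomorphic_on UNIV"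
    and eqv: "\<And>\<zeta>. \<zeta> \<in> \<Omega> \<Longrightarrow> f (\<zeta> + 1) = \<tau> (f \<zeta>)"
  shows "\<exists>F. F holomorphic_on UNIV \<and> (\<forall>\<zeta>\<in>\<Omega>. F \<zeta> = f \<zeta>) \<and> (\<forall>\<zeta>. F (\<zeta> + 1) = \<tau> (F \<zeta>))"
proof -
  define N where "N \<zeta> = (LEAST m::nat. \<zeta> + of_nat m \<in> \<Omega>)" for \<zeta>
  define F where "F \<zeta> = (\<tau>' ^^ N \<zeta>) (f (\<zeta> + of_nat (N \<zeta>)))" for \<zeta>
  \<comment> \<open>The least shift in the definition is only a choice: raising the shift by one
    applies \<tau> to the value of \<open>f\<close>, which the additional \<tau>' cancels.\<close>
  have F: "F \<zeta> = (\<tau>' ^^ m) (f (\<zeta> + of_nat m))" if m: "\<zeta> + of_nat m \<in> \<Omega>" for \<zeta> and m :: nat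
  proof -
    have N: "\<zeta> + of_nat (N \<zeta>) \<in> \<Omega>" unfolding N_def using cover by (rule LeastI_ex)
    have "N \<zeta> \<le> m" unfolding N_def using m by (rule Least_le)
    then show ?thesis
    proof -
      have "\<zeta> + of_nat n \<in> \<Omega> \<and> F \<zeta> = (\<tau>' ^^ n) (f (\<zeta> + of_nat n))" if "N \<zeta> \<le> n" for n
        using that
      proof (induction n rule: dec_induct)
        case base
        then show ?case using N by (simp add: F_def)
      next
        case (step n)
        have *: "\<zeta> + of_nat (Suc n) = (\<zeta> + of_nat n) + 1" by simp
        show ?case
          unfolding * using step assms(2) eqv by (simp add: funpow_swap1 inv)
      qed
      then show ?thesis using \<open>N \<zeta> \<le> m\<close> by blast
    qed
  qed
  have pow: "(\<tau>' ^^ m) holomorphic_on UNIV" for m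
  proof (induction m)
    case (Suc m)
    then show ?case
      unfolding funpow.simps by (rule holomorphic_on_compose_gen[OF _ hol']) auto
  qed (simp add: id_def)
  have "F field_differentiable at \<zeta>" for \<zeta>
  proof -
    obtain m :: nat where m: "\<zeta> + of_nat m \<in> \<Omega>" using cover by blast
    \<comment> \<open>One shift \<open>m\<close> serves the whole neighbourhood \<open>T\<close> of
      \<zeta>, so \<open>F\<close> is there a composition of holomorphic maps.\<close>
    define T where "T = (\<lambda>z. z + of_nat m) -` \<Omega>"
    have T: "open T" "\<zeta> \<in> T"
      unfolding T_def using m by (auto intro!: open_vimage \<Omega> continuous_intros)
    have "(f \<circ> (\<lambda>z. z + of_nat m)) holomorphic_on T"
      by (rule holomorphic_on_compose_gen[OF _ hol]) (auto simp: T_def intro!: holomorphic_intros)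
    then have "((\<tau>' ^^ m) \<circ> (f \<circ> (\<lambda>z. z + of_nat m))) holomorphic_on T"
      by (rule holomorphic_on_compose_gen[OF _ pow]) auto
    then have "F holomorphic_on T"
      by (rule holomorphic_transform) (simp add: T_def F)
    then show ?thesis using T by (intro holomorphic_on_imp_differentiable_at)
  qed
  then have "F holomorphic_on UNIV" by (simp add: holomorphic_on_def)
  moreover have "F \<zeta> = f \<zeta>" if "\<zeta> \<in> \<Omega>" for \<zeta> using F[of \<zeta> 0] that by simp
  moreover have "F (\<zeta> + 1) = \<tau> (F \<zeta>)" for \<zeta>
  proof -
    obtain m :: nat where m: "\<zeta> + of_nat m \<in> \<Omega>" using cover by blast
    have comm: "(\<tau>' ^^ n) (\<tau> w) = \<tau> ((\<tau>' ^^ n) w)" for n w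
      by (induction n) (auto simp: inv)
    have eq: "\<zeta> + 1 + of_nat m = (\<zeta> + of_nat m) + 1" by simp
    have "F (\<zeta> + 1) = (\<tau>' ^^ m) (f ((\<zeta> + of_nat m) + 1))"
      using F[of "\<zeta> + 1" m] step[OF m] unfolding eq by simp
    also have "\<dots> = \<tau> (F \<zeta>)" using eqv[OF m] F[OF m] comm by simp
    finally show ?thesis .
  qed
  ultimately show ?thesis by blast
qed

section \<open>Grand orbits and canonical maps\<close>

lemma funpow_semiconj:
  assumes "\<And>z. z \<in> X \<Longrightarrow> \<psi> z \<in> X" "\<And>z. z \<in> X \<Longrightarrow> f (\<psi> z) = \<tau> (f z)" "z \<in> X"
  shows "(\<psi> ^^ n) z \<in> X" "f ((\<psi> ^^ n) z) = (\<tau> ^^ n) (f z)"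
proof -
  have "(\<psi> ^^ n) z \<in> X \<and> f ((\<psi> ^^ n) z) = (\<tau> ^^ n) (f z)"
    by (induction n) (use assms in auto)
  then show "(\<psi> ^^ n) z \<in> X" "f ((\<psi> ^^ n) z) = (\<tau> ^^ n) (f z)" by auto
qed

lemma equiv_grand_orbit_rel: "equiv X (grand_orbit_rel X \<psi>)"
proof (rule equivI)
  show "refl_on X (grand_orbit_rel X \<psi>)" by (auto simp: refl_on_def grand_orbit_rel_def)
  show "sym (grand_orbit_rel X \<psi>)" unfolding sym_def grand_orbit_rel_def by clarsimp metis
  show "trans (grand_orbit_rel X \<psi>)"
  proof (rule transI)
    fix x y z assume "(x, y) \<in> grand_orbit_rel X \<psi>" "(y, z) \<in> grand_orbit_rel X \<psi>"
    then obtain n k m l where X: "x \<in> X" "z \<in> X"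
      and *: "(\<psi> ^^ n) x = (\<psi> ^^ k) y" "(\<psi> ^^ m) y = (\<psi> ^^ l) z"
      by (auto simp: grand_orbit_rel_def)
    \<comment> \<open>Both sides equal \<open>(\<psi> ^^ (m + k)) y\<close>, since iterates
      commute.\<close>
    have "(\<psi> ^^ (m + n)) x = (\<psi> ^^ (k + l)) z"
      by (metis "*" add.commute comp_apply funpow_add)
    then show "(x, z) \<in> grand_orbit_rel X \<psi>" using X by (auto simp: grand_orbit_rel_def)
  qed
  show "grand_orbit_rel X \<psi> \<subseteq> X \<times> X" by (auto simp: grand_orbit_rel_def)
qed

text \<open>The induced map can be evaluated on a representative: \<open>f\<close> sends the orbit
  of \<open>z\<close> into the orbit of \<open>f z\<close>, so saturating the image gives exactly
  that orbit.\<close>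

lemma induced_orbit_map_class:
  assumes "\<And>z. z \<in> X \<Longrightarrow> \<psi> z \<in> X" "\<And>z. z \<in> X \<Longrightarrow> f (\<psi> z) = \<tau> (f z)" "z \<in> X"
  shows "induced_orbit_map \<tau> f (grand_orbit_rel X \<psi> `` {z}) = grand_orbit_rel UNIV \<tau> `` {f z}"
proof -
  have rel: "(f z, f w) \<in> grand_orbit_rel UNIV \<tau>" if zw: "(z, w) \<in> grand_orbit_rel X \<psi>" for w
  proof -
    obtain n k where "w \<in> X" "(\<psi> ^^ n) z = (\<psi> ^^ k) w"
      using zw by (auto simp: grand_orbit_rel_def)
    then have "(\<tau> ^^ n) (f z) = (\<tau> ^^ k) (f w)"
      using funpow_semiconj(2)[of X \<psi> f \<tau>] assms by metis
    then show ?thesis by (auto simp: grand_orbit_rel_def)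
  qed
  have self: "(z, z) \<in> grand_orbit_rel X \<psi>"
    using assms(3) by (auto simp: grand_orbit_rel_def)
  have eqv: "equiv UNIV (grand_orbit_rel UNIV \<tau>)" by (rule equiv_grand_orbit_rel)
  show ?thesis
    unfolding induced_orbit_map_def
    using rel self equiv_class_eq[OF eqv] by blast
qed

text \<open>The induced map of \<open>s\<close> is that of \<open>F\<close> after that of
  \<open>h\<close>. As the latter is a bijection, the composite is bijective exactly when the
  induced map of \<open>F\<close> is.\<close>

lemma canonical_factor:
  assumes \<psi>: "\<And>z. z \<in> X \<Longrightarrow> \<psi> z \<in> X"
    and h: "\<And>z. z \<in> X \<Longrightarrow> h (\<psi> z) = T (h z)"
    and F: "\<And>w. F (T w) = \<tau> (F w)"
    and s: "\<And>z. z \<in> X \<Longrightarrow> s z = F (h z)"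
    and can: "canonical X \<psi> T h"
  shows "canonical X \<psi> \<tau> s \<longleftrightarrow> canonical UNIV T \<tau> F"
proof -
  have "(induced_orbit_map \<tau> F \<circ> induced_orbit_map T h) A = induced_orbit_map \<tau> s A"
    if A: "A \<in> grand_orbits X \<psi>" for A
  proof -
    obtain z where z: "z \<in> X" "A = grand_orbit_rel X \<psi> `` {z}"
      using A by (auto simp: grand_orbits_def elim: quotientE)
    show ?thesis
      using induced_orbit_map_class[of X \<psi> h T z] induced_orbit_map_class[of UNIV T F \<tau> "h z"]
        induced_orbit_map_class[of X \<psi> s \<tau> z] z \<psi> h F s by simp
  qed
  then show ?thesis
    unfolding canonical_def bij_betw_comp_iff[OF can[unfolded canonical_def]]
    by (intro bij_betw_cong) simp
qed

text \<open>Separation of fibres up to iteration suffices for injectivity, because two values of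
  \<open>h\<close> in one orbit of \<open>T\<close> become equal after iterating \<psi> on both
  points.\<close>

lemma canonicalI:
  assumes "\<And>z. z \<in> X \<Longrightarrow> \<psi> z \<in> X" "\<And>z. z \<in> X \<Longrightarrow> h (\<psi> z) = T (h z)"
    and sep: "\<And>z w. z \<in> X \<Longrightarrow> w \<in> X \<Longrightarrow> h z = h w \<Longrightarrow> \<exists>m. (\<psi> ^^ m) z = (\<psi> ^^ m) w"
    and surj: "\<And>\<zeta>. \<exists>z\<in>X. \<exists>m. (T ^^ m) \<zeta> = h z"
  shows "canonical X \<psi> T h"
  unfolding canonical_def bij_betw_def
proof
  note cls = induced_orbit_map_class[of X \<psi> h T, OF assms(1,2)]
  have eqT: "equiv UNIV (grand_orbit_rel UNIV T)" and eqX: "equiv X (grand_orbit_rel X \<psi>)"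
    by (rule equiv_grand_orbit_rel)+
  show "inj_on (induced_orbit_map T h) (grand_orbits X \<psi>)"
  proof (rule inj_onI)
    fix A B assume A: "A \<in> grand_orbits X \<psi>" and B: "B \<in> grand_orbits X \<psi>"
      and eq: "induced_orbit_map T h A = induced_orbit_map T h B"
    obtain z w where z: "z \<in> X" "A = grand_orbit_rel X \<psi> `` {z}"
      and w: "w \<in> X" "B = grand_orbit_rel X \<psi> `` {w}"
      using A B by (auto simp: grand_orbits_def elim!: quotientE)
    have "grand_orbit_rel UNIV T `` {h z} = grand_orbit_rel UNIV T `` {h w}"
      using eq z w cls by simp
    then have "(h z, h w) \<in> grand_orbit_rel UNIV T"
      using eq_equiv_class[OF _ eqT] by blast
    then obtain n k where "(T ^^ n) (h z) = (T ^^ k) (h w)"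
      by (auto simp: grand_orbit_rel_def)
    then have "h ((\<psi> ^^ n) z) = h ((\<psi> ^^ k) w)"
      using funpow_semiconj(2)[of X \<psi> h T] assms(1,2) z w by simp
    then obtain m where "(\<psi> ^^ m) ((\<psi> ^^ n) z) = (\<psi> ^^ m) ((\<psi> ^^ k) w)"
      using sep funpow_semiconj(1)[of X \<psi> h T] assms(1,2) z w by metis
    then have "(\<psi> ^^ (m + n)) z = (\<psi> ^^ (m + k)) w" by (simp add: funpow_add)
    then have "(z, w) \<in> grand_orbit_rel X \<psi>" using z w by (auto simp: grand_orbit_rel_def)
    then show "A = B" using z w equiv_class_eq[OF eqX] by simp
  qed
  show "induced_orbit_map T h ` grand_orbits X \<psi> = grand_orbits UNIV T"
  proof
    show "induced_orbit_map T h ` grand_orbits X \<psi> \<subseteq> grand_orbits UNIV T"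
      using cls by (auto simp: grand_orbits_def elim!: quotientE intro!: quotientI)
    show "grand_orbits UNIV T \<subseteq> induced_orbit_map T h ` grand_orbits X \<psi>"
    proof
      fix B assume "B \<in> grand_orbits UNIV T"
      then obtain \<zeta> where B: "B = grand_orbit_rel UNIV T `` {\<zeta>}"
        by (auto simp: grand_orbits_def elim!: quotientE)
      obtain z m where z: "z \<in> X" "(T ^^ m) \<zeta> = h z" using surj by blast
      then have "(T ^^ m) \<zeta> = (T ^^ 0) (h z)" by simp
      then have "(\<zeta>, h z) \<in> grand_orbit_rel UNIV T"
        unfolding grand_orbit_rel_def by blast
      then have "B = induced_orbit_map T h (grand_orbit_rel X \<psi> `` {z})"
        using B z cls equiv_class_eq[OF eqT] by simp
      then show "B \<in> induced_orbit_map T h ` grand_orbits X \<psi>"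
        using z by (auto simp: grand_orbits_def intro: quotientI)
    qed
  qed
qed

section \<open>The orbit of the base point and the functional equation of \<open>h\<close>\<close>

locale bp_semiconjugation =
  fixes \<phi> h :: "complex \<Rightarrow> complex" and z\<^sub>0 :: complex
  assumes par: "parabolic_zero_step \<phi>"
    and Im_z0: "Im z\<^sub>0 > 0"
    and bp: "baker_pommerenke \<phi> z\<^sub>0 h"
begin

text \<open>Makes explicit the function whose existence \<open>parabolic_zero_step\<close> asserts;
  the two agree on the half-plane.\<close>

definition p :: "complex \<Rightarrow> complex" where "p w = \<phi> w - w"

definition orb :: "nat \<Rightarrow> complex" where "orb n = (\<phi> ^^ n) z\<^sub>0"

definition hseq :: "nat \<Rightarrow> complex \<Rightarrow> complex"
  where "hseq n w = ((\<phi> ^^ n) w - orb n) / p (orb n)"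

lemma hol_phi: "\<phi> holomorphic_on upper_half_plane"
  using par by (simp add: parabolic_zero_step_def)

lemma Im_phi: "Im w > 0 \<Longrightarrow> Im (\<phi> w) > 0"
  using par by (auto simp: parabolic_zero_step_def upper_half_plane_def)

lemma hol_p: "p holomorphic_on upper_half_plane"
  unfolding p_def[abs_def] by (intro holomorphic_intros hol_phi)

lemma Im_p: "Im w > 0 \<Longrightarrow> Im (p w) > 0"
  using par by (auto simp: parabolic_zero_step_def upper_half_plane_def p_def)

lemma Im_iter: "Im w > 0 \<Longrightarrow> Im ((\<phi> ^^ n) w) > 0"
  by (induction n) (auto simp: Im_phi)

lemma hol_iter: "(\<phi> ^^ n) holomorphic_on upper_half_plane"
proof (induction n)
  case (Suc n)
  then show ?case
    unfolding funpow.simps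
    by (rule holomorphic_on_compose_gen[OF _ hol_phi]) (auto simp: upper_half_plane_def Im_iter)
qed (simp add: id_def)

lemma Im_orb: "Im (orb n) > 0"
  by (simp add: orb_def Im_iter Im_z0)

lemma orb_Suc: "orb (Suc n) = orb n + p (orb n)"
  by (simp add: orb_def p_def)

lemma p_orb_nz: "p (orb n) \<noteq> 0"
  using Im_p[OF Im_orb[of n]] by auto

lemma hseq_eq_bp_mu: "hseq n w = bp_mu \<phi> z\<^sub>0 n ((\<phi> ^^ n) w)"
  by (simp add: hseq_def bp_mu_def orb_def p_def)

lemma hyp_ratio_iter_le:
  "Im z > 0 \<Longrightarrow> Im w > 0 \<Longrightarrow> hyp_ratio ((\<phi> ^^ n) z) ((\<phi> ^^ n) w) \<le> hyp_ratio z w"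
  by (rule hyp_ratio_contract[OF hol_iter Im_iter])

lemma hyp_ratio_p_le:
  "Im z > 0 \<Longrightarrow> Im w > 0 \<Longrightarrow> hyp_ratio (p z) (p w) \<le> hyp_ratio z w"
  by (rule hyp_ratio_contract[OF hol_p Im_p])

text \<open>The zero-step condition holds at some \<open>v\<close>. The orbits of \<open>v\<close>
  and of the base point stay at bounded hyperbolic distance, so two Harnack estimates, for
  \<open>p\<close> and for the points, transfer the decay at the cost of a factor
  \<open>(K + 2)\<^sup>2\<close>.\<close>

lemma small_step: "(\<lambda>n. cmod (p (orb n)) / Im (orb n)) \<longlonglongrightarrow> 0"
proof -
  obtain v where v: "Im v > 0"
    and lim: "(\<lambda>n. hyp_dist ((\<phi> ^^ n) v) ((\<phi> ^^ Suc n) v)) \<longlonglongrightarrow> 0"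
    using par by (auto simp: parabolic_zero_step_def upper_half_plane_def)
  define y where "y n = (\<phi> ^^ n) v" for n
  have y: "Im (y n) > 0" "y (Suc n) = y n + p (y n)" for n
    by (simp_all add: y_def Im_iter v p_def)
  define q where "q n = hyp_ratio (y (Suc n)) (y n)" for n
  have "(\<lambda>n. 2 * (cosh (hyp_dist (y n) (y (Suc n))) - 1)) \<longlonglongrightarrow> 2 * (cosh 0 - 1)"
    using lim unfolding y_def by (intro tendsto_intros)
  then have q0: "q \<longlonglongrightarrow> 0"
    using hyp_ratio_eq_hyp_dist[OF y(1) y(1)] by (simp add: q_def[abs_def] hyp_dist_commute)
  have qnn: "q n \<ge> 0" for n
    unfolding q_def by (intro hyp_ratio_nonneg y)
  \<comment> \<open>The definition of \<open>q\<close> expresses the size of \<open>p (y n)\<close>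
    through \<open>Im (y (Suc n)) * Im (y n)\<close>, and Harnack removes the index
    \<open>Suc n\<close>.\<close>
  have tq: "cmod (p (y n)) / Im (y n) \<le> sqrt (q n * (q n + 2))" for n
  proof (rule real_le_rsqrt)
    have "(cmod (p (y n)))\<^sup>2 = q n * (Im (y (Suc n)) * Im (y n))"
      using y(1)[of n] y(1)[of "Suc n"] by (simp add: q_def hyp_ratio_def) (simp add: y(2))
    also have "\<dots> \<le> q n * ((q n + 2) * Im (y n) * Im (y n))"
      using Harnack_Im[OF y(1) y(1), of "Suc n" n "q n"] y(1)[of n] qnn[of n]
      by (intro mult_left_mono mult_right_mono) (auto simp: q_def)
    finally show "(cmod (p (y n)) / Im (y n))\<^sup>2 \<le> q n * (q n + 2)"
      using y(1)[of n] by (simp add: power_divide pos_divide_le_eq power2_eq_square mult.assoc)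
  qed
  define K where "K = hyp_ratio z\<^sub>0 v"
  have K: "K \<ge> 0" unfolding K_def by (intro hyp_ratio_nonneg v Im_z0)
  have le: "hyp_ratio (orb n) (y n) \<le> K" for n
    unfolding orb_def y_def K_def by (rule hyp_ratio_iter_le[OF Im_z0 v])
  have bound: "cmod (p (orb n)) / Im (orb n) \<le> (K + 2)\<^sup>2 * sqrt (q n * (q n + 2))" for n
  proof -
    have 1: "cmod (p (orb n)) \<le> (K + 2) * cmod (p (y n))"
      using hyp_ratio_p_le[OF Im_orb y(1)] le order_trans
      by (intro Harnack_cmod Im_p Im_orb y(1)) blast
    have 2: "Im (y n) \<le> (K + 2) * Im (orb n)"
      using le by (intro Harnack_Im Im_orb y(1)) (simp add: hyp_ratio_commute)
    have "cmod (p (orb n)) * Im (y n) \<le> ((K + 2) * cmod (p (y n))) * ((K + 2) * Im (orb n))"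
      using y(1)[of n] K by (intro mult_mono 1 2) auto
    then have "cmod (p (orb n)) / Im (orb n) \<le> (K + 2)\<^sup>2 * (cmod (p (y n)) / Im (y n))"
      using y(1)[of n] Im_orb[of n] by (simp add: field_simps power2_eq_square)
    also have "\<dots> \<le> (K + 2)\<^sup>2 * sqrt (q n * (q n + 2))"
      by (intro mult_left_mono tq) simp
    finally show ?thesis .
  qed
  have "(\<lambda>n. (K + 2)\<^sup>2 * sqrt (q n * (q n + 2))) \<longlonglongrightarrow> (K + 2)\<^sup>2 * sqrt (0 * (0 + 2))"
    by (intro tendsto_intros q0)
  then have "(\<lambda>n. (K + 2)\<^sup>2 * sqrt (q n * (q n + 2))) \<longlonglongrightarrow> 0" by simp
  then show ?thesis
    by (rule Lim_null_comparison[rotated])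
       (use bound Im_orb in \<open>auto intro!: always_eventually simp: less_imp_le\<close>)
qed

text \<open>Consecutive orbit points are hyperbolically close by \<open>small_step\<close>;
  Schwarz-Pick passes this on to their images under \<open>p\<close>, and hyperbolically close
  points have ratio close to 1.\<close>

lemma step_ratio: "(\<lambda>n. p (orb (Suc n)) / p (orb n)) \<longlonglongrightarrow> 1"
proof -
  define q where "q n = (cmod (p (orb n)) / Im (orb n))\<^sup>2" for n
  have q0: "q \<longlonglongrightarrow> 0"
    using tendsto_power[OF small_step, of 2] by (simp add: q_def[abs_def])
  have bound: "cmod (p (orb (Suc n)) / p (orb n) - 1) \<le> sqrt (q n * (q n + 2))" for n
  proof (rule real_le_rsqrt)
    let ?a = "p (orb (Suc n))" and ?b = "p (orb n)"
    have "hyp_ratio (orb (Suc n)) (orb n) = (cmod ?b)\<^sup>2 / (Im (orb (Suc n)) * Im (orb n))"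
      by (simp add: hyp_ratio_def orb_Suc)
    \<comment> \<open>Imaginary parts increase along the orbit because
      \<open>Im p > 0\<close>.\<close>
    also have "\<dots> \<le> (cmod ?b)\<^sup>2 / (Im (orb n) * Im (orb n))"
      using Im_orb[of n] Im_p[OF Im_orb[of n]] by (intro divide_left_mono) (auto simp: orb_Suc)
    finally have "hyp_ratio (orb (Suc n)) (orb n) \<le> q n"
      by (simp add: q_def power_divide power2_eq_square)
    then have le: "hyp_ratio ?a ?b \<le> q n"
      using hyp_ratio_p_le[OF Im_orb Im_orb, of "Suc n" n] by simp
    have "(cmod (?a - ?b))\<^sup>2 \<le> q n * (Im ?a * Im ?b)"
      using le Im_p[OF Im_orb[of n]] Im_p[OF Im_orb[of "Suc n"]]
      by (simp add: hyp_ratio_def pos_divide_le_eq)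
    also have "\<dots> \<le> q n * (cmod ?a * cmod ?b)"
      using Im_p[OF Im_orb[of n]] abs_Im_le_cmod[of ?a] abs_Im_le_cmod[of ?b]
      by (intro mult_left_mono mult_mono) (auto simp: q_def)
    also have "\<dots> \<le> q n * (((q n + 2) * cmod ?b) * cmod ?b)"
      by (intro mult_left_mono mult_right_mono Harnack_cmod Im_p Im_orb le) (auto simp: q_def)
    finally have "(cmod (?a - ?b))\<^sup>2 \<le> q n * (q n + 2) * (cmod ?b)\<^sup>2"
      by (simp add: power2_eq_square mult.assoc)
    moreover have "?a / ?b - 1 = (?a - ?b) / ?b" using p_orb_nz[of n] by (simp add: field_simps)
    ultimately show "(cmod (?a / ?b - 1))\<^sup>2 \<le> q n * (q n + 2)"
      using p_orb_nz[of n] by (simp add: norm_divide power_divide pos_divide_le_eq)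
  qed
  have "(\<lambda>n. sqrt (q n * (q n + 2))) \<longlonglongrightarrow> sqrt (0 * (0 + 2))"
    by (intro tendsto_intros q0)
  then have "(\<lambda>n. sqrt (q n * (q n + 2))) \<longlonglongrightarrow> 0" by simp
  then have "(\<lambda>n. p (orb (Suc n)) / p (orb n) - 1) \<longlonglongrightarrow> 0"
    by (rule Lim_null_comparison[rotated]) (use bound in \<open>auto intro!: always_eventually\<close>)
  then show ?thesis by (simp add: LIM_zero_iff)
qed

lemma hseq_uniform_limit:
  "compact K \<Longrightarrow> K \<subseteq> upper_half_plane \<Longrightarrow> uniform_limit K hseq h sequentially"
  using bp by (simp add: baker_pommerenke_def hseq_eq_bp_mu[abs_def])

lemma hseq_tendsto: "Im w > 0 \<Longrightarrow> (\<lambda>n. hseq n w) \<longlonglongrightarrow> h w"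
  using tendsto_uniform_limitI[OF hseq_uniform_limit[of "{w}"]]
  by (simp add: upper_half_plane_def)

lemma hol_hseq: "hseq n holomorphic_on upper_half_plane"
  unfolding hseq_def[abs_def] by (intro holomorphic_intros hol_iter p_orb_nz)

lemma hol_h: "h holomorphic_on upper_half_plane"
proof (rule holomorphic_uniform_sequence[OF open_upper_half_plane hol_hseq])
  fix x assume "x \<in> upper_half_plane"
  then obtain d where "d > 0" "cball x d \<subseteq> upper_half_plane"
    using open_upper_half_plane open_contains_cball_eq by blast
  then show "\<exists>d>0. cball x d \<subseteq> upper_half_plane \<and> uniform_limit (cball x d) hseq h sequentially"
    using hseq_uniform_limit[OF compact_cball] by (intro exI[of _ d]) simp
qed

text \<open>Changing the centre and scale of \<open>hseq\<close> from index \<open>n\<close> to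
  \<open>Suc n\<close> costs a summand 1 and a factor that tends to 1 by
  \<open>step_ratio\<close>.\<close>

lemma h_phi:
  assumes "Im w > 0"
  shows "h (\<phi> w) = h w + 1"
proof -
  have "hseq n (\<phi> w) = hseq (Suc n) w * (p (orb (Suc n)) / p (orb n)) + 1" for n
    using p_orb_nz[of n] p_orb_nz[of "Suc n"]
    by (simp add: hseq_def funpow_swap1 orb_Suc) (simp add: field_simps)
  moreover have "(\<lambda>n. hseq (Suc n) w * (p (orb (Suc n)) / p (orb n)) + 1) \<longlonglongrightarrow> h w * 1 + 1"
    by (intro tendsto_intros step_ratio LIMSEQ_Suc hseq_tendsto assms)
  ultimately show ?thesis
    using hseq_tendsto[OF Im_phi[OF assms]] LIMSEQ_unique by (simp, blast)
qed

lemma h_iter: "Im w > 0 \<Longrightarrow> h ((\<phi> ^^ n) w) = h w + of_nat n"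
  by (induction n) (auto simp: h_phi Im_iter)

lemma h_orb: "h (orb n) = of_nat n"
proof -
  have "h z\<^sub>0 = 0"
    using hseq_tendsto[OF Im_z0] by (simp add: hseq_def orb_def LIMSEQ_const_iff)
  then show ?thesis by (simp add: orb_def h_iter Im_z0)
qed

lemma h_not_constant: "\<not> h constant_on upper_half_plane"
proof
  assume "h constant_on upper_half_plane"
  then have "h (orb 0) = h (orb 1)"
    using Im_orb by (auto simp: constant_on_def upper_half_plane_def)
  then show False by (simp add: h_orb)
qed

section \<open>Injectivity near the orbit and the fibres of \<open>h\<close>\<close>

text \<open>Where \<open>Im p < Im\<close>, Schwarz-Pick makes \<open>p\<close> a strict Euclidean contraction, so
  \<open>z \<mapsto> z + p z\<close> is injective there.\<close>

lemma phi_injective_near_orb: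
  assumes "K > 0"
  shows "\<exists>M. \<forall>m\<ge>M. inj_on \<phi> {z. Im z > 0 \<and> hyp_ratio z (orb m) < K}"
proof -
  \<comment> \<open>Harnack is used once for values of \<open>p\<close> and once for the points,
    each time losing a factor \<open>K + 2\<close>; hence the threshold.\<close>
  have "\<forall>\<^sub>F m in sequentially. cmod (p (orb m)) / Im (orb m) < 1 / (K + 2)\<^sup>2"
    by (rule order_tendstoD[OF small_step]) (use assms in auto)
  then obtain M where M: "\<And>m. m \<ge> M \<Longrightarrow> cmod (p (orb m)) / Im (orb m) < 1 / (K + 2)\<^sup>2"
    by (auto simp: eventually_sequentially)
  have "inj_on \<phi> {z. Im z > 0 \<and> hyp_ratio z (orb m) < K}" if "m \<ge> M" for m
  proof (rule inj_onI, clarify)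
    have small: "Im (p z) < Im z" if z: "Im z > 0" "hyp_ratio z (orb m) < K" for z
    proof -
      have "Im (p z) \<le> (K + 2) * Im (p (orb m))"
        using z hyp_ratio_p_le[OF z(1) Im_orb[of m]] by (intro Harnack_Im Im_p Im_orb) auto
      also have "\<dots> \<le> (K + 2) * cmod (p (orb m))"
        using assms abs_Im_le_cmod[of "p (orb m)"] by (intro mult_left_mono) auto
      finally have 1: "(K + 2) * Im (p z) \<le> (K + 2) * ((K + 2) * cmod (p (orb m)))"
        using assms by simp
      have "(K + 2) * ((K + 2) * cmod (p (orb m))) < Im (orb m)"
        using M[OF \<open>m \<ge> M\<close>] Im_orb[of m] assms
        by (simp add: divide_simps power2_eq_square mult_ac)
      also have "Im (orb m) \<le> (K + 2) * Im z"
        using z by (intro Harnack_Im Im_orb) (auto simp: hyp_ratio_commute)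
      finally have "(K + 2) * Im (p z) < (K + 2) * Im z" using 1 by simp
      then show ?thesis using assms by simp
    qed
    fix z w assume z: "Im z > 0" "hyp_ratio z (orb m) < K"
      and w: "Im w > 0" "hyp_ratio w (orb m) < K" and eq: "\<phi> z = \<phi> w"
    \<comment> \<open>Equal images force \<open>p\<close> to preserve the distance of
      \<open>z\<close> and \<open>w\<close>, which contradicts strict contraction unless
      \<open>z = w\<close>.\<close>
    have d: "p z - p w = w - z" using eq by (simp add: p_def)
    have "(cmod (p z - p w))\<^sup>2 * (Im z * Im w) \<le> (cmod (z - w))\<^sup>2 * (Im (p z) * Im (p w))"
      by (rule Schwarz_Pick_half_plane[OF hol_p Im_p z(1) w(1)])
    then have le: "(cmod (z - w))\<^sup>2 * (Im z * Im w) \<le> (cmod (z - w))\<^sup>2 * (Im (p z) * Im (p w))"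
      unfolding d by (simp add: norm_minus_commute)
    have lt: "Im (p z) * Im (p w) < Im z * Im w"
      using small[OF z] small[OF w] Im_p[OF z(1)] Im_p[OF w(1)] by (intro mult_strict_mono) auto
    show "z = w"
      using le lt by (metis linorder_not_less mult_less_cancel_left_pos right_minus_eq
          zero_less_norm_iff zero_less_power)
  qed
  then show ?thesis by blast
qed

text \<open>Iterates carry the disc about \<open>orb m\<close> into discs of the same hyperbolic
  radius further along the orbit, where \<phi> is injective. So every \<open>hseq n\<close> is
  injective on it, and Hurwitz passes this to the limit \<open>h\<close>.\<close>

lemma h_injective_near_orb:
  assumes K: "hyp_ratio (\<phi> z\<^sub>0) z\<^sub>0 < K"
  shows "\<exists>M. \<forall>m\<ge>M. inj_on h {z. Im z > 0 \<and> hyp_ratio z (orb m) < K}"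
proof -
  have K0: "K > 0" using K hyp_ratio_nonneg[OF Im_phi[OF Im_z0] Im_z0] by linarith
  define D where "D m = {z. Im z > 0 \<and> hyp_ratio z (orb m) < K}" for m
  obtain M where M: "\<And>m. m \<ge> M \<Longrightarrow> inj_on \<phi> (D m)"
    using phi_injective_near_orb[OF K0] unfolding D_def by blast
  have maps: "(\<phi> ^^ n) z \<in> D (n + m)" if "z \<in> D m" for n m z
    using hyp_ratio_iter_le[OF _ Im_orb, of z n m] that
    by (auto simp: D_def Im_iter orb_def funpow_add)
  have inj_iter: "inj_on (\<phi> ^^ n) (D m)" if "m \<ge> M" for n m
  proof (induction n)
    case (Suc n)
    have "inj_on \<phi> ((\<phi> ^^ n) ` D m)"
      using maps that by (intro inj_on_subset[OF M[of "n + m"]]) auto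
    then show ?case unfolding funpow.simps using Suc by (intro comp_inj_on)
  qed simp
  have "inj_on h (D m)" if "m \<ge> M" for m
  proof -
    obtain c r where cr: "D m = ball c r"
      using hyp_ball_eq_ball[OF Im_orb K0] unfolding D_def by blast
    have sub: "D m \<subseteq> upper_half_plane" by (auto simp: D_def upper_half_plane_def)
    show ?thesis
    proof (rule Hurwitz_injective)
      show "open (D m)" "connected (D m)" by (simp_all add: cr)
      show "hseq n holomorphic_on D m" for n by (rule holomorphic_on_subset[OF hol_hseq sub])
      show "h holomorphic_on D m" by (rule holomorphic_on_subset[OF hol_h sub])
      show "uniform_limit C hseq h sequentially" if "compact C" "C \<subseteq> D m" for C
        using that sub by (intro hseq_uniform_limit) auto
      show "inj_on (hseq n) (D m)" for n
        using inj_iter[OF \<open>m \<ge> M\<close>, of n] p_orb_nz[of n]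
        by (auto simp: inj_on_def hseq_def)
      \<comment> \<open>The lower bound on \<open>K\<close> puts two consecutive orbit points into
        the disc; \<open>h\<close> takes the values \<open>m\<close> and \<open>m + 1\<close> there,
        so it is not constant.\<close>
      have "z\<^sub>0 \<in> D 0" "\<phi> z\<^sub>0 \<in> D 0"
        using K K0 Im_z0 by (simp_all add: D_def orb_def Im_phi, simp add: hyp_ratio_def)
      from this[THEN maps[of _ 0 m]] have "orb m \<in> D m" "orb (Suc m) \<in> D m" by (simp_all add: orb_def funpow_swap1)
      then show "\<not> h constant_on D m"
        by (metis constant_on_def h_orb of_nat_eq_iff n_not_Suc_n)
    qed
  qed
  then show ?thesis unfolding D_def by blast
qed

lemma h_eq_imp_orbits_meet:
  assumes z: "Im z > 0" and w: "Im w > 0" and eq: "h z = h w"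
  shows "\<exists>m. (\<phi> ^^ m) z = (\<phi> ^^ m) w"
proof -
  \<comment> \<open>Large enough for \<open>h_injective_near_orb\<close> and for the disc about the
    base point to contain \<open>z\<close> and \<open>w\<close>; adding 1 makes the inequalities
    strict.\<close>
  define K where "K = max (hyp_ratio (\<phi> z\<^sub>0) z\<^sub>0) (max (hyp_ratio z z\<^sub>0) (hyp_ratio w z\<^sub>0)) + 1"
  obtain m where m: "inj_on h {z. Im z > 0 \<and> hyp_ratio z (orb m) < K}"
    using h_injective_near_orb[of K] unfolding K_def by force
  have mem: "(\<phi> ^^ m) x \<in> {z. Im z > 0 \<and> hyp_ratio z (orb m) < K}"
    if "Im x > 0" "hyp_ratio x z\<^sub>0 < K" for x
    using hyp_ratio_iter_le[OF that(1) Im_z0, of m] that by (auto simp: orb_def Im_iter)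
  have K: "hyp_ratio z z\<^sub>0 < K" "hyp_ratio w z\<^sub>0 < K" by (auto simp: K_def)
  have "h ((\<phi> ^^ m) z) = h ((\<phi> ^^ m) w)" using z w eq by (simp add: h_iter)
  then have "(\<phi> ^^ m) z = (\<phi> ^^ m) w"
    by (rule inj_onD[OF m]) (rule mem[OF z K(1)], rule mem[OF w K(2)])
  then show ?thesis ..
qed

section \<open>Covering the plane by translates of the image of \<open>h\<close>\<close>

text \<open>If every integer translate of \<open>u\<close> were omitted by \<open>h\<close>, the rescaled maps
  \<open>g n \<zeta> = h (orb n + \<zeta> p(orb n)) - n\<close>, whose domains exhaust the plane, would all omit
  \<open>u\<close> and \<open>u + 1\<close>, hence form a normal family. Since \<open>g n \<circ> hseq n = h\<close>, their limit is the
  identity, which does not omit \<open>u\<close>.\<close>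

lemma translates_cover_plane: "\<exists>m::nat. u + of_nat m \<in> h ` upper_half_plane"
proof (rule ccontr)
  assume no: "\<not> ?thesis"
  \<comment> \<open>The disc of radius \<open>R\<close> contains both 0, where the identity theorem
    starts, and \<open>u\<close>, where the contradiction arises. Doubling \<open>R\<close> leaves
    room for Schottky.\<close>
  define R where "R = cmod u + 1"
  have R: "R > 0" by (simp add: R_def add_nonneg_pos)
  define \<nu> where "\<nu> n \<zeta> = orb n + \<zeta> * p (orb n)" for n \<zeta>
  define g where "g n \<zeta> = h (\<nu> n \<zeta>) - of_nat n" for n \<zeta>
  have "\<forall>\<^sub>F n in sequentially. cmod (p (orb n)) / Im (orb n) < 1 / (2 * R)"
    by (rule order_tendstoD[OF small_step]) (use R in auto)
  then obtain N where N: "\<And>n. n \<ge> N \<Longrightarrow> cmod (p (orb n)) / Im (orb n) < 1 / (2 * R)"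
    by (auto simp: eventually_sequentially)
  have Im\<nu>: "Im (\<nu> n \<zeta>) > 0" if n: "n \<ge> N" and \<zeta>: "\<zeta> \<in> cball 0 (2 * R)" for n \<zeta>
  proof -
    have "\<bar>Im (\<zeta> * p (orb n))\<bar> \<le> cmod \<zeta> * cmod (p (orb n))"
      using abs_Im_le_cmod[of "\<zeta> * p (orb n)"] by (simp add: norm_mult)
    also have "\<dots> \<le> 2 * R * cmod (p (orb n))"
      using \<zeta> by (intro mult_right_mono) auto
    also have "\<dots> < Im (orb n)"
      using N[OF n] R Im_orb[of n] by (simp add: field_simps)
    finally show ?thesis by (simp add: \<nu>_def)
  qed
  have holg: "g n holomorphic_on cball 0 (2 * R)" if "n \<ge> N" for n
  proof -
    have "(h \<circ> \<nu> n) holomorphic_on cball 0 (2 * R)"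
      by (rule holomorphic_on_compose_gen[OF _ hol_h])
         (use Im\<nu>[OF that] in \<open>auto simp: \<nu>_def[abs_def] upper_half_plane_def intro!: holomorphic_intros\<close>)
    then show ?thesis unfolding g_def[abs_def] o_def by (intro holomorphic_intros)
  qed
  have omit: "g n \<zeta> \<noteq> u" "g n \<zeta> \<noteq> u + 1" if "n \<ge> N" "\<zeta> \<in> cball 0 (2 * R)" for n \<zeta>
  proof -
    have "h (\<nu> n \<zeta>) \<in> h ` upper_half_plane"
      using Im\<nu>[OF that] by (auto simp: upper_half_plane_def)
    then have "h (\<nu> n \<zeta>) \<noteq> u + of_nat n" "h (\<nu> n \<zeta>) \<noteq> u + of_nat (Suc n)"
      using no by metis+
    then show "g n \<zeta> \<noteq> u" "g n \<zeta> \<noteq> u + 1" by (auto simp: g_def algebra_simps)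
  qed
  \<comment> \<open>Schottky's bound on the disc of radius 1/2 for a function with value at most
    \<open>cmod u\<close> at 0, plus \<open>cmod u\<close> for undoing the translation by
    \<open>u\<close>.\<close>
  define B where "B = exp (pi * exp (pi * (2 + 2 * cmod u + 12 * (1 / 2) / (1 - 1 / 2)))) + cmod u"
  have bound: "cmod (g n \<zeta>) \<le> B" if n: "n \<ge> N" and \<zeta>: "\<zeta> \<in> ball 0 R" for n \<zeta>
  proof -
    \<comment> \<open>Rescaling to the unit disc and subtracting \<open>u\<close> turns the omitted
      values into 0 and 1.\<close>
    define f where "f x = g n (2 * of_real R * x) - u" for x
    have in2R: "2 * of_real R * x \<in> cball 0 (2 * R)" if "x \<in> cball 0 1" for x :: complex
      using that R by (simp add: norm_mult)
    have "(g n \<circ> (\<lambda>x. 2 * of_real R * x)) holomorphic_on cball 0 1"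
      by (rule holomorphic_on_compose_gen[OF _ holg[OF n]])
         (use in2R in \<open>auto intro!: holomorphic_intros\<close>)
    then have holf: "f holomorphic_on cball 0 1"
      unfolding f_def[abs_def] o_def by (intro holomorphic_intros)
    have f01: "\<not> (f x = 0 \<or> f x = 1)" if "x \<in> cball 0 1" for x
      using omit[OF n in2R[OF that]] by (auto simp: f_def algebra_simps)
    have f0: "cmod (f 0) \<le> cmod u" by (simp add: f_def g_def \<nu>_def h_orb)
    define x where "x = \<zeta> / (2 * of_real R)"
    have "cmod x \<le> 1 / 2" using \<zeta> R by (simp add: x_def norm_divide norm_mult field_simps)
    then have "cmod (f x) \<le> B - cmod u"
      using Schottky[OF holf f0 f01, of "1/2" x] by (simp add: B_def)
    moreover have "g n \<zeta> = f x + u" using R by (simp add: f_def x_def)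
    ultimately show ?thesis using norm_triangle_ineq[of "f x" u] by simp
  qed
  define \<H> where "\<H> = {f. f holomorphic_on ball 0 R \<and> (\<forall>\<zeta>\<in>ball 0 R. cmod (f \<zeta>) \<le> B)}"
  obtain G r where G: "G holomorphic_on ball 0 R" "strict_mono (r :: nat \<Rightarrow> nat)"
    "\<And>C. compact C \<Longrightarrow> C \<subseteq> ball 0 R \<Longrightarrow> uniform_limit C ((\<lambda>n. g (n + N)) \<circ> r) G sequentially"
  proof (rule Montel[of "ball 0 R" \<H> "\<lambda>n. g (n + N)"])
    show "\<exists>B. \<forall>f\<in>\<H>. \<forall>z\<in>C. cmod (f z) \<le> B" if "C \<subseteq> ball 0 R" for C
      using that unfolding \<H>_def by blast
    have sub: "ball 0 R \<subseteq> (cball 0 (2 * R) :: complex set)" using R by auto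
    show "range (\<lambda>n. g (n + N)) \<subseteq> \<H>"
      using bound holomorphic_on_subset[OF holg sub] by (auto simp: \<H>_def)
  qed (auto simp: \<H>_def)
  define s where "s n = r n + N" for n
  have s: "filterlim s sequentially sequentially"
    unfolding s_def by (rule filterlim_compose[OF filterlim_add_const_nat_at_top filterlim_subseq[OF G(2)]])
  have Gid_range: "G \<zeta> = \<zeta>" if \<zeta>: "\<zeta> \<in> h ` upper_half_plane \<inter> ball 0 R" for \<zeta>
  proof -
    obtain z where z: "Im z > 0" "\<zeta> = h z" using \<zeta> by (auto simp: upper_half_plane_def)
    obtain d where d: "d > 0" "cball \<zeta> d \<subseteq> ball 0 R"
      using \<zeta> open_contains_cball[of "ball 0 R"] by blast
    have lim: "(\<lambda>n. hseq (s n) z) \<longlonglongrightarrow> \<zeta>"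
      unfolding z(2) by (rule filterlim_compose[OF hseq_tendsto[OF z(1)] s])
    \<comment> \<open>The arguments \<open>hseq (s n) z\<close> converge to \<zeta> while the values
      remain \<zeta>; uniform convergence near \<zeta> then gives
      \<open>G \<zeta> = \<zeta>\<close>.\<close>
    have gh: "g n (hseq n z) = \<zeta>" for n
      using p_orb_nz[of n] z by (simp add: g_def \<nu>_def hseq_def h_iter)
    have "(\<lambda>n. \<zeta> - G (hseq (s n) z)) \<longlonglongrightarrow> 0"
    proof (rule tendstoI)
      fix e :: real assume "e > 0"
      then have "\<forall>\<^sub>F n in sequentially. \<forall>x\<in>cball \<zeta> d. dist (g (s n) x) (G x) < e"
        using uniform_limitD[OF G(3)[OF compact_cball d(2)]] by (simp add: s_def)
      moreover have "\<forall>\<^sub>F n in sequentially. dist (hseq (s n) z) \<zeta> < d"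
        using tendstoD[OF lim d(1)] .
      ultimately show "\<forall>\<^sub>F n in sequentially. dist (\<zeta> - G (hseq (s n) z)) 0 < e"
      proof eventually_elim
        case (elim n)
        then have "hseq (s n) z \<in> cball \<zeta> d" by (simp add: dist_commute)
        then show ?case using elim(1) gh[of "s n"] by (force simp: dist_norm)
      qed
    qed
    moreover have "isCont G \<zeta>"
      using holomorphic_on_imp_continuous_on[OF G(1)] \<zeta> by (simp add: continuous_on_eq_continuous_at)
    then have "(\<lambda>n. \<zeta> - G (hseq (s n) z)) \<longlonglongrightarrow> \<zeta> - G \<zeta>"
      by (intro tendsto_intros isCont_tendsto_compose[OF _ lim])
    ultimately show ?thesis using LIMSEQ_unique by fastforce
  qed
  have Gid: "G \<zeta> = \<zeta>" if "\<zeta> \<in> ball 0 R" for \<zeta>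
  proof (rule analytic_continuation_open[where s = "h ` upper_half_plane \<inter> ball 0 R" and s' = "ball 0 R"
        and f = G and g = "\<lambda>\<zeta>. \<zeta>"])
    show "open (h ` upper_half_plane \<inter> ball 0 R)"
      using open_mapping_thm[OF hol_h open_upper_half_plane connected_upper_half_plane open_upper_half_plane order_refl h_not_constant]
      by (intro open_Int) auto
    have "h (orb 0) \<in> h ` upper_half_plane \<inter> ball 0 R"
      using R Im_orb[of 0] by (intro IntI imageI) (simp_all add: h_orb upper_half_plane_def)
    then show "h ` upper_half_plane \<inter> ball 0 R \<noteq> {}" by blast
  qed (use G(1) Gid_range that in auto)
  \<comment> \<open>Hurwitz: the functions \<open>g (s n) - u\<close> have no zeros, so neither has
    their nonconstant limit \<open>\<zeta> - u\<close>; evaluating at \<open>u\<close> is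
    absurd.\<close>
  have "u - u \<noteq> 0"
  proof (rule Hurwitz_no_zeros[of "ball 0 R" "\<lambda>n \<zeta>. g (s n) \<zeta> - u" "\<lambda>\<zeta>. \<zeta> - u"])
    have sub: "ball 0 R \<subseteq> (cball 0 (2 * R) :: complex set)" using R by auto
    show "(\<lambda>\<zeta>. g (s n) \<zeta> - u) holomorphic_on ball 0 R" for n
      by (intro holomorphic_intros holomorphic_on_subset[OF holg sub]) (simp add: s_def)
    show "uniform_limit C (\<lambda>n \<zeta>. g (s n) \<zeta> - u) (\<lambda>\<zeta>. \<zeta> - u) sequentially"
      if C: "compact C" "C \<subseteq> ball 0 R" for C
    proof -
      have "uniform_limit C (\<lambda>n \<zeta>. g (s n) \<zeta> - u) (\<lambda>\<zeta>. G \<zeta> - u) sequentially"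
        using G(3)[OF C] by (intro uniform_limit_intros) (simp add: s_def o_def)
      then show ?thesis
        by (rule uniform_limit_cong'[THEN iffD1, rotated 2]) (use Gid C in auto)
    qed
    show "\<not> (\<lambda>\<zeta>. \<zeta> - u) constant_on ball 0 R"
    proof
      assume "(\<lambda>\<zeta>. \<zeta> - u) constant_on ball 0 R"
      then obtain c where c: "\<And>\<zeta>. \<zeta> \<in> ball 0 R \<Longrightarrow> \<zeta> - u = c"
        by (auto simp: constant_on_def)
      have "0 - u = c" "of_real (R / 2) - u = c" using c[of 0] c[of "of_real (R / 2)"] R by auto
      then have "of_real (R / 2) = (0 :: complex)" by (metis diff_add_cancel)
      then show False using R by simp
    qed
    show "g (s n) \<zeta> - u \<noteq> 0" if "\<zeta> \<in> ball 0 R" for n \<zeta>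
      using omit(1)[of "s n" \<zeta>] that sub by (auto simp: s_def)
    show "u \<in> ball 0 R" by (simp add: R_def)
  qed (auto intro!: holomorphic_intros)
  then show False by simp
qed

section \<open>Canonicity of \<open>h\<close> and the factorisation of semiconjugations\<close>

lemma h_canonical: "canonical upper_half_plane \<phi> (\<lambda>z. z + 1) h"
proof (rule canonicalI)
  fix \<zeta>
  obtain m :: nat and z where "z \<in> upper_half_plane" "\<zeta> + of_nat m = h z"
    using translates_cover_plane by (metis imageE)
  moreover have "((\<lambda>z. z + 1) ^^ m) \<zeta> = \<zeta> + of_nat m" by (induction m) auto
  ultimately show "\<exists>z\<in>upper_half_plane. \<exists>m. ((\<lambda>z. z + 1) ^^ m) \<zeta> = h z" by metis
next
  fix z w assume "z \<in> upper_half_plane" "w \<in> upper_half_plane" "h z = h w"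
  then show "\<exists>m. (\<phi> ^^ m) z = (\<phi> ^^ m) w"
    using h_eq_imp_orbits_meet by (simp add: upper_half_plane_def)
qed (simp_all add: upper_half_plane_def Im_phi h_phi)

text \<open>On a fibre of \<open>h\<close> orbits meet after \<open>m\<close> steps; injectivity of
  \<open>\<tau> ^^ m\<close> then makes \<sigma> constant there, so it descends to the image of
  \<open>h\<close> and extends by translation.\<close>

lemma semiconjugation_factors:
  assumes hols: "\<sigma> holomorphic_on upper_half_plane"
    and inv: "\<And>w. \<tau>' (\<tau> w) = w" "\<And>w. \<tau> (\<tau>' w) = w" and hol': "\<tau>' holomorphic_on UNIV"
    and eqv: "\<And>z. z \<in> upper_half_plane \<Longrightarrow> \<sigma> (\<phi> z) = \<tau> (\<sigma> z)"
  shows "\<exists>F. F holomorphic_on UNIV \<and> (\<forall>z\<in>upper_half_plane. F (h z) = \<sigma> z) \<and>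
    (\<forall>\<zeta>. F (\<zeta> + 1) = \<tau> (F \<zeta>))"
proof -
  have maps: "\<phi> z \<in> upper_half_plane" if "z \<in> upper_half_plane" for z
    using that Im_phi by (simp add: upper_half_plane_def)
  have hphi: "h (\<phi> z) = h z + 1" if "z \<in> upper_half_plane" for z
    using that h_phi by (simp add: upper_half_plane_def)
  have inj: "inj (\<tau> ^^ m)" for m
    using inv(1) by (metis inj_fn injI)
  have fib: "\<sigma> z = \<sigma> w" if zw: "z \<in> upper_half_plane" "w \<in> upper_half_plane" "h z = h w" for z w
  proof -
    obtain m where m: "(\<phi> ^^ m) z = (\<phi> ^^ m) w"
      using h_eq_imp_orbits_meet zw by (auto simp: upper_half_plane_def)
    have "(\<tau> ^^ m) (\<sigma> z) = (\<tau> ^^ m) (\<sigma> w)"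
      using funpow_semiconj(2)[of upper_half_plane \<phi> \<sigma> \<tau>, OF maps eqv] m zw by metis
    then show ?thesis using inj by (simp add: inj_eq)
  qed
  have "\<exists>f. f holomorphic_on h ` upper_half_plane \<and> (\<forall>z\<in>upper_half_plane. f (h z) = \<sigma> z)"
    by (rule holomorphic_factor_through[OF open_upper_half_plane connected_upper_half_plane hol_h h_not_constant hols])
       (rule fib)
  then obtain f where f: "f holomorphic_on h ` upper_half_plane"
    "\<And>z. z \<in> upper_half_plane \<Longrightarrow> f (h z) = \<sigma> z"
    by blast
  have "\<exists>F. F holomorphic_on UNIV \<and> (\<forall>\<zeta>\<in>h ` upper_half_plane. F \<zeta> = f \<zeta>) \<and>
    (\<forall>\<zeta>. F (\<zeta> + 1) = \<tau> (F \<zeta>))"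
  proof (rule entire_extension_by_translation[of "h ` upper_half_plane" f \<tau>' \<tau>])
    show "open (h ` upper_half_plane)"
      using open_mapping_thm[OF hol_h open_upper_half_plane connected_upper_half_plane open_upper_half_plane order_refl h_not_constant] .
    fix \<zeta> assume "\<zeta> \<in> h ` upper_half_plane"
    then obtain z where z: "z \<in> upper_half_plane" "\<zeta> = h z" by blast
    have \<zeta>1: "\<zeta> + 1 = h (\<phi> z)" using hphi z by simp
    show "\<zeta> + 1 \<in> h ` upper_half_plane" unfolding \<zeta>1 by (intro imageI maps z)
    show "f (\<zeta> + 1) = \<tau> (f \<zeta>)"
      using eqv[OF z(1)] f(2)[OF maps[OF z(1)]] f(2)[OF z(1)] \<zeta>1 z(2) by simp
  next
    show "\<exists>m::nat. \<zeta> + of_nat m \<in> h ` upper_half_plane" for \<zeta>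
      by (rule translates_cover_plane)
  qed (fact f(1) inv hol')+
  then obtain F where F: "F holomorphic_on UNIV"
    "\<And>\<zeta>. \<zeta> \<in> h ` upper_half_plane \<Longrightarrow> F \<zeta> = f \<zeta>" "\<And>\<zeta>. F (\<zeta> + 1) = \<tau> (F \<zeta>)"
    by blast
  have "F (h z) = \<sigma> z" if "z \<in> upper_half_plane" for z
    using F(2)[OF imageI[OF that]] f(2)[OF that] by simp
  then show ?thesis using F(1,3) by blast
qed

end

theorem proposition7p5:
  fixes \<phi> h \<sigma> \<tau> :: "complex \<Rightarrow> complex" and z\<^sub>0 :: complex
  assumes "parabolic_zero_step \<phi>"
    and "z\<^sub>0 \<in> upper_half_plane"
    and "baker_pommerenke \<phi> z\<^sub>0 h"
    and "(\<sigma>, \<tau>) \<in> semiconjugations \<phi>"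
  shows "\<exists>F. F holomorphic_on UNIV \<and>
    (\<forall>z\<in>upper_half_plane. \<sigma> z = F (h z)) \<and>
    (\<forall>z. F (z + 1) = \<tau> (F z)) \<and>
    (canonical upper_half_plane \<phi> \<tau> \<sigma> \<longleftrightarrow> canonical UNIV (\<lambda>z. z + 1) \<tau> F)"
proof -
  interpret bp_semiconjugation \<phi> h z\<^sub>0
    using assms by unfold_locales (auto simp: upper_half_plane_def)
  obtain a b where ab: "a \<noteq> 0" "\<tau> = (\<lambda>z. a * z + b)"
    and \<sigma>: "\<sigma> holomorphic_on upper_half_plane"
      "\<And>z. z \<in> upper_half_plane \<Longrightarrow> \<sigma> (\<phi> z) = \<tau> (\<sigma> z)"
    using assms(4) by (auto simp: semiconjugations_def Aut_C_def)
  have inv: "(\<tau> w - b) / a = w" "\<tau> ((w - b) / a) = w" for w using ab by auto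
  have hol': "(\<lambda>w. (w - b) / a) holomorphic_on UNIV" using ab by (intro holomorphic_intros) auto
  have "\<exists>F. F holomorphic_on UNIV \<and> (\<forall>z\<in>upper_half_plane. F (h z) = \<sigma> z) \<and>
    (\<forall>\<zeta>. F (\<zeta> + 1) = \<tau> (F \<zeta>))"
    by (rule semiconjugation_factors[OF \<sigma>(1) inv hol']) (rule \<sigma>(2))
  then obtain F where F: "F holomorphic_on UNIV"
    "\<And>z. z \<in> upper_half_plane \<Longrightarrow> F (h z) = \<sigma> z" "\<And>\<zeta>. F (\<zeta> + 1) = \<tau> (F \<zeta>)"
    by blast
  have "canonical upper_half_plane \<phi> \<tau> \<sigma> \<longleftrightarrow> canonical UNIV (\<lambda>z. z + 1) \<tau> F"
  proof (rule canonical_factor[where h = h])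
    show "\<phi> z \<in> upper_half_plane" "h (\<phi> z) = h z + 1" if "z \<in> upper_half_plane" for z
      using that by (simp_all add: upper_half_plane_def Im_phi h_phi)
  qed (simp_all only: F h_canonical)
  then show ?thesis using F(1) F(2)[symmetric] F(3) by blast
qed

end
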